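(* For every $h\ge 3$ there exists a translation KM-arc of type $2^{h-2}$ in $\mathrm{PG}(2,2^h)$. In other words, for every even $q\ge 8$ there is a translation set $\mathcal{A}$ in $\mathrm{PG}(2,q)$ of size $q+q/4$ such that every line meets $\mathcal{A}$ in $0$, $2$ or $q/4$ points.
   Context: A KM-arc of type $t$ in $\mathrm{PG}(2,q)$ is a set of $q+t$ points such that every line meets it in $0$, $2$ or $t$ points, each of these values occurring. A point set $S$ is a translation set with respect to a line $\ell$ if the group of elations of $\mathrm{PG}(2,q)$ with axis $\ell$ fixing $S$ acts transitively on $S\setminus\ell$; a translation KM-arc is a KM-arc that is a translation set with respect to some line. *)

theory Defs
  imports "HOL-Analysis.Cartesian_Space" "HOL-Combinatorics.Permutations"
begin

text \<open>
  For a finite field type \<open>'a\<close> with \<open>q = CARD('a)\<close>, the plane PG(2,q) has as points and lines the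
  subspaces of \<open>'a ^ 3\<close> of vector space dimension 1 and 2; incidence is containment.
\<close>

definition pg_points :: "('a::field ^ 3) set set" where
  "pg_points = {P. vec.subspace P \<and> vec.dim P = 1}"

definition pg_lines :: "('a::field ^ 3) set set" where
  "pg_lines = {l. vec.subspace l \<and> vec.dim l = 2}"

definition points_on :: "('a::field ^ 3) set \<Rightarrow> ('a ^ 3) set set" where
  "points_on l = {P \<in> pg_points. P \<subseteq> l}"

text \<open>
  A collineation is given by its action on points. Using \<open>permutes\<close> makes it the identity on sets
  of vectors that are not points, so that it is determined by that action.
\<close>

definition collineation :: "(('a::field ^ 3) set \<Rightarrow> ('a ^ 3) set) \<Rightarrow> bool" where
  "collineation \<phi> \<longleftrightarrow>
     \<phi> permutes pg_points \<and> (\<forall>l\<in>pg_lines. \<exists>m\<in>pg_lines. \<phi> ` points_on l = points_on m)"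

text \<open>
  An elation with axis \<open>l\<close> fixes every point of \<open>l\<close> and every line through some point of \<open>l\<close> (its
  centre). The identity counts as an elation, so the elations with axis \<open>l\<close> form a group.
\<close>

definition elations :: "('a::field ^ 3) set \<Rightarrow> (('a ^ 3) set \<Rightarrow> ('a ^ 3) set) set" where
  "elations l = {\<phi>. collineation \<phi> \<and> (\<forall>P\<in>points_on l. \<phi> P = P) \<and>
     (\<exists>C\<in>points_on l. \<forall>m\<in>pg_lines. C \<subseteq> m \<longrightarrow> \<phi> ` points_on m = points_on m)}"

definition translation_set_wrt :: "('a::field ^ 3) set \<Rightarrow> ('a ^ 3) set set \<Rightarrow> bool" where
  "translation_set_wrt l S \<longleftrightarrow> l \<in> pg_lines \<and> S \<subseteq> pg_points \<and>
     (\<forall>P\<in>S - points_on l. \<forall>Q\<in>S - points_on l. \<exists>\<phi>\<in>elations l. \<phi> ` S = S \<and> \<phi> P = Q)"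

definition translation_set :: "('a::field ^ 3) set set \<Rightarrow> bool" where
  "translation_set S \<longleftrightarrow> (\<exists>l. translation_set_wrt l S)"

text \<open>Equality with \<open>{0, 2, t}\<close>, rather than inclusion, says that each value occurs.\<close>

definition KM_arc :: "nat \<Rightarrow> ('a::{field,finite} ^ 3) set set \<Rightarrow> bool" where
  "KM_arc t S \<longleftrightarrow> S \<subseteq> pg_points \<and> card S = CARD('a) + t \<and>
     (\<lambda>l. card (S \<inter> points_on l)) ` pg_lines = {0, 2, t}"

definition translation_KM_arc :: "nat \<Rightarrow> ('a::{field,finite} ^ 3) set set \<Rightarrow> bool" where
  "translation_KM_arc t S \<longleftrightarrow> KM_arc t S \<and> translation_set S"

end

theory Submission
  imports Defs
begin

text \<open>
  In characteristic 2, let \<open>g\<close> be an additive map on \<open>F\<close> whose graph \<open>U = {(g y, y)}\<close> meets every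
  line through the origin in at most one nonzero vector, except for the line \<open>x = 0\<close>, which it meets
  in the kernel of \<open>g\<close>, of size \<open>t > 1\<close>. An affine line then meets \<open>U\<close> in 0 or 2 points if its
  direction is one of those determined by \<open>U\<close> (in 0 or \<open>t\<close> points for the direction \<open>x = 0\<close>),
  and in exactly 1 point otherwise. Adding to \<open>U\<close> the \<open>t\<close> points at infinity that are not determined
  gives a KM-arc of type \<open>t\<close>, on which the translations by \<open>U\<close> act.

  For \<open>t = q/4\<close> take an additive \<open>f : F \<rightarrow> {0, 1}\<close>, which is not identically 0, some \<open>b\<close> other than
  0 and 1, and \<open>g y = f y + (1 + b) * f (b * y)\<close>. If \<open>(g y, y)\<close> and \<open>(g z, z)\<close> are proportional with
  \<open>g y \<noteq> g z\<close>, then \<open>(1 + b) y = z\<close>, \<open>b y = z\<close> or \<open>b y = (1 + b) z\<close> (up to exchanging \<open>y\<close> and \<open>z\<close>),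
  and applying \<open>f\<close> to this relation gives a contradiction.
\<close>

section \<open>Points and lines of the plane in homogeneous coordinates\<close>

definition dot3 :: "'a::field ^ 3 \<Rightarrow> 'a ^ 3 \<Rightarrow> 'a" where
  "dot3 n v = n$1 * v$1 + n$2 * v$2 + n$3 * v$3"

definition line_of :: "'a::field ^ 3 \<Rightarrow> ('a ^ 3) set" where
  "line_of n = {v. dot3 n v = 0}"

abbreviation point_of :: "'a::field ^ 3 \<Rightarrow> ('a ^ 3) set" where
  "point_of v \<equiv> vec.span {v}"

lemma vec3_eq_iff: "v = w \<longleftrightarrow> v$1 = w$1 \<and> v$2 = w$2 \<and> v$3 = w$3" for v w :: "'a ^ 3"
  by (simp add: vec_eq_iff forall_3)

lemma dot3_linear: "dot3 n (v + w) = dot3 n v + dot3 n w" "dot3 n (c *s v) = c * dot3 n v"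
  "dot3 n (v - w) = dot3 n v - dot3 n w"
  by (simp_all add: dot3_def algebra_simps)

lemma subspace_line_of: "vec.subspace (line_of n)"
  by (rule vec.subspaceI) (simp_all add: line_of_def dot3_linear, simp add: dot3_def)

lemma dot3_nontrivial:
  assumes "n \<noteq> 0"
  obtains e where "dot3 n e \<noteq> 0"
proof -
  have "n$1 \<noteq> 0 \<or> n$2 \<noteq> 0 \<or> n$3 \<noteq> 0"
    using assms by (auto simp: vec3_eq_iff)
  moreover have "dot3 n (vector [1,0,0]) = n$1" "dot3 n (vector [0,1,0]) = n$2"
    "dot3 n (vector [0,0,1]) = n$3"
    by (simp_all add: dot3_def)
  ultimately show ?thesis by (metis that)
qed

text \<open>One vector \<open>e\<close> outside the kernel of the nonzero functional
  \<open>dot3 n\<close> spans the whole space together with that kernel.\<close>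

lemma dim_line_of:
  fixes n :: "'a::field ^ 3"
  assumes "n \<noteq> 0"
  shows "vec.dim (line_of n) = 2"
proof -
  obtain e where e: "dot3 n e \<noteq> 0" using dot3_nontrivial[OF assms] .
  have s: "vec.span (line_of n) = line_of n"
    using subspace_line_of vec.span_eq_iff by blast
  have "v \<in> vec.span (insert e (line_of n))" for v
  proof -
    have "v - (dot3 n v / dot3 n e) *s e \<in> line_of n"
      using e by (simp add: line_of_def dot3_linear)
    then show ?thesis unfolding vec.span_insert s by blast
  qed
  then have "vec.span (insert e (line_of n)) = UNIV" by blast
  then have "vec.dim (insert e (line_of n)) = 3"
    using vec.dim_span[of "insert e (line_of n)"] vec_dim_card[where 'a='a and 'n=3] by simp
  moreover have "e \<notin> line_of n" using e by (simp add: line_of_def)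
  ultimately show ?thesis unfolding vec.dim_insert s by simp
qed

lemma line_of_in_pg_lines: "n \<noteq> 0 \<Longrightarrow> line_of n \<in> pg_lines"
  by (simp add: pg_lines_def subspace_line_of dim_line_of)

lemma pg_lines_cases:
  fixes l :: "('a::field ^ 3) set"
  assumes "l \<in> pg_lines"
  obtains n where "n \<noteq> 0" "l = line_of n"
proof -
  from assms have l: "vec.subspace l" "vec.dim l = 2" by (auto simp: pg_lines_def)
  obtain B where B: "B \<subseteq> l" "vec.independent B" "l \<subseteq> vec.span B" "card B = 2"
    using vec.basis_exists[of l] l(2) by metis
  obtain u v where uv: "B = {u, v}" "u \<noteq> v" using B(4) by (meson card_2_iff)
  have u: "u \<noteq> 0" using B(2) uv vec.dependent_zero by blast
  have v: "v \<noteq> k *s u" for k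
  proof
    assume "v = k *s u"
    then have "v \<in> vec.span {u}" unfolding vec.span_singleton by blast
    moreover have "B - {v} = {u}" using uv by auto
    ultimately show False using B(2) uv unfolding vec.dependent_def by auto
  qed
  \<comment> \<open>The cross product of \<open>u\<close> and \<open>v\<close>, orthogonal to both;
    it is nonzero because \<open>v\<close> is not a multiple of \<open>u\<close>.\<close>
  define n where "n = (vector [u$2 * v$3 - u$3 * v$2, u$3 * v$1 - u$1 * v$3, u$1 * v$2 - u$2 * v$1] :: 'a ^ 3)"
  have "n \<noteq> 0"
  proof
    assume "n = 0"
    then have n: "u$2 * v$3 = u$3 * v$2" "u$3 * v$1 = u$1 * v$3" "u$1 * v$2 = u$2 * v$1"
      by (auto simp: n_def vec3_eq_iff)
    from u consider "u$1 \<noteq> 0" | "u$2 \<noteq> 0" | "u$3 \<noteq> 0" by (auto simp: vec3_eq_iff)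
    then show False
    proof cases
      case 1 then show False using v[of "v$1 / u$1"] n by (auto simp: vec3_eq_iff field_simps)
    next
      case 2 then show False using v[of "v$2 / u$2"] n by (auto simp: vec3_eq_iff field_simps)
    next
      case 3 then show False using v[of "v$3 / u$3"] n by (auto simp: vec3_eq_iff field_simps)
    qed
  qed
  moreover have "B \<subseteq> line_of n"
    unfolding uv line_of_def by (auto simp: n_def dot3_def algebra_simps)
  then have "l \<subseteq> line_of n"
    using B(3) vec.span_minimal[OF _ subspace_line_of] by blast
  then have "l = line_of n"
    using vec.subspace_dim_equal[OF l(1) subspace_line_of, of n] dim_line_of[OF \<open>n \<noteq> 0\<close>] l(2) by simp
  ultimately show ?thesis using that by blast
qed

lemma point_of_in_pg_points: "v \<noteq> 0 \<Longrightarrow> point_of v \<in> pg_points"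
  by (simp add: pg_points_def)

lemma pg_points_cases:
  fixes P :: "('a::field ^ 3) set"
  assumes "P \<in> pg_points"
  obtains v where "v \<noteq> 0" "P = point_of v"
proof -
  from assms have P: "vec.subspace P" "vec.dim P = 1" by (auto simp: pg_points_def)
  obtain B where B: "B \<subseteq> P" "vec.independent B" "P \<subseteq> vec.span B" "card B = 1"
    using vec.basis_exists[of P] P(2) by metis
  obtain v where v: "B = {v}" using B(4) card_1_singletonE by blast
  have "v \<noteq> 0" using B(2) v vec.dependent_zero by blast
  moreover have "P = vec.span {v}" using B v P(1) vec.span_minimal by blast
  ultimately show ?thesis using that by blast
qed

lemma point_of_subset_line_of: "point_of v \<subseteq> line_of n \<longleftrightarrow> dot3 n v = 0"
proof
  assume "point_of v \<subseteq> line_of n"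
  then show "dot3 n v = 0" using vec.span_base[of v "{v}"] by (auto simp: line_of_def)
qed (auto simp: vec.span_singleton line_of_def dot3_linear)

lemma point_of_on: "v \<noteq> 0 \<Longrightarrow> point_of v \<in> points_on (line_of n) \<longleftrightarrow> dot3 n v = 0"
  by (simp add: points_on_def point_of_in_pg_points point_of_subset_line_of)

lemma point_of_eqE:
  assumes "point_of v = point_of w"
  obtains k where "v = k *s w"
  using assms vec.span_base[of v "{v}"] by (auto simp: vec.span_singleton)

section \<open>Elations whose axis is the line at infinity\<close>

definition shear :: "'a::field ^ 3 \<Rightarrow> 'a ^ 3 \<Rightarrow> 'a ^ 3" where
  "shear d v = v + v$3 *s d"

text \<open>For \<open>d$3 = 0\<close> this acts on the affine chart \<open>v$3 = 1\<close> as
  translation by \<open>d\<close>. The value outside \<open>pg_points\<close> is the one that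
  \<open>permutes\<close> demands.\<close>

definition shear_map :: "'a::field ^ 3 \<Rightarrow> ('a ^ 3) set \<Rightarrow> ('a ^ 3) set" where
  "shear_map d P = (if P \<in> pg_points then shear d ` P else P)"

definition infinity_line :: "('a::field ^ 3) set" where
  "infinity_line = line_of (vector [0, 0, 1])"

lemma linear_shear: "Vector_Spaces.linear (*s) (*s) (shear (d :: 'a::field ^ 3))"
  by unfold_locales (simp_all add: shear_def vec3_eq_iff algebra_simps)

lemma shear_point_of: "shear d ` point_of v = point_of (shear d v)"
  using vec.linear_span_image[OF linear_shear, of d "{v}"] by simp

lemma shear_map_point_of: "v \<noteq> 0 \<Longrightarrow> shear_map d (point_of v) = point_of (shear d v)"
  by (simp add: shear_map_def point_of_in_pg_points shear_point_of)

lemma dot3_shear: "dot3 n (shear d v) = dot3 n v + v$3 * dot3 n d"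
  by (simp add: shear_def dot3_linear)

context
  fixes d :: "'a::field ^ 3"
  assumes two: "(2::'a) = 0" and d3: "d$3 = 0"
begin

text \<open>Both applications add the same multiple of \<open>d\<close>, since
  \<open>d$3 = 0\<close> preserves the third coordinate. As its own inverse, a shear yields converse
  inclusions from direct ones.\<close>

lemma shear_shear: "shear d (shear d v) = v"
  by (simp add: shear_def vec3_eq_iff d3 two)

lemma shear_dim: "vec.dim (shear d ` P) = vec.dim P"
  by (rule vec.dim_image_eq[OF linear_shear]) (metis shear_shear inj_onI)

lemma shear_subspace: "vec.subspace P \<Longrightarrow> vec.subspace (shear d ` P)"
  by (rule vec.linear_subspace_image[OF linear_shear])

lemma shear_in_pg_points: "P \<in> pg_points \<Longrightarrow> shear d ` P \<in> pg_points"
  by (simp add: pg_points_def shear_dim shear_subspace)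

lemma shear_in_pg_lines: "l \<in> pg_lines \<Longrightarrow> shear d ` l \<in> pg_lines"
  by (simp add: pg_lines_def shear_dim shear_subspace)

lemma shear_map_involution: "shear_map d (shear_map d P) = P"
  by (simp add: shear_map_def shear_in_pg_points image_image shear_shear)

lemma shear_map_points_on: "shear_map d ` points_on l = points_on (shear d ` l)"
proof
  show *: "shear_map d ` points_on l \<subseteq> points_on (shear d ` l)" for l
    by (auto simp: points_on_def shear_map_def shear_in_pg_points)
  show "points_on (shear d ` l) \<subseteq> shear_map d ` points_on l"
  proof
    fix P assume "P \<in> points_on (shear d ` l)"
    then have "shear_map d P \<in> points_on l"
      using *[of "shear d ` l"] by (auto simp: image_image shear_shear)
    then show "P \<in> shear_map d ` points_on l"
      by (metis shear_map_involution image_eqI)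
  qed
qed

lemma shear_map_collineation: "collineation (shear_map d)"
  unfolding collineation_def
proof
  show "shear_map d permutes pg_points"
    unfolding permutes_def by (metis shear_map_involution shear_map_def)
  show "\<forall>l\<in>pg_lines. \<exists>m\<in>pg_lines. shear_map d ` points_on l = points_on m"
    using shear_map_points_on shear_in_pg_lines by blast
qed

text \<open>The centre is the direction of \<open>d\<close>: a line through it satisfies
  \<open>dot3 n d = 0\<close>, so its equation is invariant under \<open>shear d\<close>.\<close>

lemma shear_map_elation: "shear_map d \<in> elations infinity_line"
proof -
  have fixed: "shear_map d P = P" if P: "P \<in> points_on infinity_line" for P
  proof -
    obtain v where v: "v \<noteq> 0" "P = point_of v"
      using P pg_points_cases unfolding points_on_def by blast
    then have "v$3 = 0" using P point_of_on[of v] by (simp add: infinity_line_def dot3_def)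
    then show ?thesis using v by (simp add: shear_map_point_of shear_def)
  qed
  \<comment> \<open>For \<open>d = 0\<close> the map is the identity and any point at infinity
    serves as centre.\<close>
  obtain c k where c: "c \<noteq> 0" "c$3 = 0" "d = k *s c"
  proof (cases "d = 0")
    case True
    then show ?thesis using that[of "vector [1,0,0]" 0] by (simp add: vec3_eq_iff)
  next
    case False
    then show ?thesis using that[of d 1] d3 by simp
  qed
  have "point_of c \<in> points_on infinity_line"
    using c by (simp add: infinity_line_def point_of_on dot3_def)
  moreover have "shear_map d ` points_on m = points_on m" if m: "m \<in> pg_lines" "point_of c \<subseteq> m" for m
  proof -
    obtain n where n: "m = line_of n" using pg_lines_cases[OF m(1)] by blast
    then have "dot3 n d = 0" using m(2) c by (simp add: point_of_subset_line_of dot3_linear)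
    then have "shear d v \<in> m \<longleftrightarrow> v \<in> m" for v by (simp add: n line_of_def dot3_shear)
    then have "shear d ` m = m" using shear_shear by (metis image_eqI image_subsetI subsetI subset_antisym)
    then show ?thesis by (simp add: shear_map_points_on)
  qed
  ultimately show ?thesis
    unfolding elations_def using shear_map_collineation fixed by blast
qed

end

section \<open>Fibres of additive maps\<close>

lemma two_eq_0_add_self: "(2::'a::ring_1) = 0 \<Longrightarrow> x + x = (0::'a)"
  by (metis mult_2 mult_zero_left)

text \<open>A nonempty fibre is a coset of the kernel.\<close>

lemma card_fibre_additive:
  fixes g :: "'a::{finite, ab_group_add} \<Rightarrow> 'b::ab_group_add"
  assumes add: "\<And>x y. g (x + y) = g x + g y"
  shows "card {y. g y = c} = (if c \<in> range g then card {y. g y = 0} else 0)"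
proof (cases "c \<in> range g")
  case True
  then obtain x where x: "c = g x" by blast
  have "g (y - x) = g y - g x" for y using add[of "y - x" x] by simp
  then have "bij_betw (\<lambda>y. y + x) {y. g y = 0} {y. g y = c}"
    by (intro bij_betwI[of _ _ _ "\<lambda>y. y - x"]) (auto simp: x add)
  then show ?thesis using True bij_betw_same_card by fastforce
next
  case False
  then have "{y. g y = c} = {}" by auto
  then show ?thesis using False by simp
qed

lemma card_range_additive:
  fixes g :: "'a::{finite, ab_group_add} \<Rightarrow> 'b::ab_group_add"
  assumes add: "\<And>x y. g (x + y) = g x + g y"
  shows "CARD('a) = card (range g) * card {y. g y = 0}"
proof -
  have "CARD('a) = (\<Sum>c\<in>range g. card {y. g y = c})"
    using sum.image_gen[of "UNIV :: 'a set" "\<lambda>_. 1 :: nat" g] by simp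
  also have "\<dots> = (\<Sum>c\<in>range g. card {y. g y = 0})"
    by (rule sum.cong) (simp_all add: card_fibre_additive[of g, OF add])
  finally show ?thesis by simp
qed

section \<open>The arc attached to an additive map: its size, line intersections and
  translations\<close>

locale translation_map =
  fixes g :: "'a::{field, finite} \<Rightarrow> 'a"
  assumes two: "(2::'a) = 0"
    and add: "g (x + y) = g x + g y"
    and slope_inj: "g y * z = g z * y \<Longrightarrow> g y * z \<noteq> 0 \<Longrightarrow> y = z"
    and kernel: "\<exists>w. w \<noteq> 0 \<and> g w = 0"
begin

lemmas add_self = two_eq_0_add_self[OF two]

lemma uminus_id: "- x = (x::'a)"
  using add_self[of x] by (simp add: add_eq_0_iff)

lemma add_eq_0: "x + y = 0 \<longleftrightarrow> x = (y::'a)"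
  by (metis add_eq_0_iff uminus_id)

lemma g_0: "g 0 = 0"
  using add[of 0 0] by (metis add_self)

text \<open>The directions not determined by the graph of \<open>g\<close> are the points \<open>(s, 1, 0)\<close> with \<open>s\<close> in the
  following set, and \<open>(1, 0, 0)\<close>.\<close>

definition free_slopes :: "'a set" where
  "free_slopes = {s. \<forall>y. g y = s * y \<longrightarrow> y = 0}"

text \<open>The last nonzero coordinate of each representative is 1, which makes
  \<open>point_of\<close> injective on them.\<close>

definition reps :: "('a ^ 3) set" where
  "reps = range (\<lambda>y. vector [g y, y, 1]) \<union> (\<lambda>s. vector [s, 1, 0]) ` free_slopes \<union> {vector [1, 0, 0]}"

definition arc :: "('a ^ 3) set set" where
  "arc = point_of ` reps"

lemma reps_nonzero: "v \<in> reps \<Longrightarrow> v \<noteq> 0"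
  by (auto simp: reps_def vec3_eq_iff)

lemma inj_on_reps: "inj_on point_of reps"
proof (rule inj_onI)
  fix v w assume vw: "v \<in> reps" "w \<in> reps" and eq: "point_of v = point_of w"
  obtain k where "v = k *s w" using eq by (rule point_of_eqE)
  then show "v = w" using vw by (auto simp: reps_def vec3_eq_iff)
qed

lemma zero_not_free: "0 \<notin> free_slopes"
  using kernel by (auto simp: free_slopes_def)

text \<open>Let t be the size of the kernel. By \<open>slope_inj\<close>, each \<open>y\<close>
  outside the kernel has its own nonzero slope \<open>g y / y\<close>, and the kernel determines
  slope 0. So \<open>1 + (q - t)\<close> slopes are determined and \<open>t - 1\<close> are free;
  the point \<open>(1, 0, 0)\<close> brings these to t.\<close>

lemma card_free_slopes: "card free_slopes + 1 = card {y. g y = 0}"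
proof -
  let ?I = "(\<lambda>y. g y / y) ` {y. g y \<noteq> 0}"
  have nz: "y \<noteq> 0" if "g y \<noteq> 0" for y using that g_0 by auto
  have "inj_on (\<lambda>y. g y / y) {y. g y \<noteq> 0}"
  proof (rule inj_onI)
    fix y z assume "y \<in> {y. g y \<noteq> 0}" "z \<in> {y. g y \<noteq> 0}" and eq: "g y / y = g z / z"
    then have "g y \<noteq> 0" "y \<noteq> 0" "z \<noteq> 0" using nz by auto
    then have "g y * z = g z * y" "g y \<noteq> 0 \<and> z \<noteq> 0" using eq by (simp_all add: frac_eq_eq)
    then show "y = z" using slope_inj mult_eq_0_iff by blast
  qed
  then have "card ?I = card {y. g y \<noteq> 0}" by (rule card_image)
  moreover have "{y. g y \<noteq> 0} = UNIV - {y. g y = 0}" by auto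
  ultimately have I: "card ?I = CARD('a) - card {y. g y = 0}" by (simp add: card_Diff_subset)
  have "s \<in> free_slopes \<longleftrightarrow> s \<noteq> 0 \<and> s \<notin> ?I" for s
  proof
    assume "s \<in> free_slopes"
    then have free: "\<And>y. g y = s * y \<Longrightarrow> y = 0" by (simp add: free_slopes_def)
    have "s \<noteq> g y / y" if "g y \<noteq> 0" for y
    proof
      assume "s = g y / y"
      then have "g y = s * y" using nz[OF that] by simp
      then show False using free nz[OF that] by blast
    qed
    then have "s \<notin> ?I" by (simp add: image_iff)
    then show "s \<noteq> 0 \<and> s \<notin> ?I" using zero_not_free \<open>s \<in> free_slopes\<close> by metis
  next
    assume s: "s \<noteq> 0 \<and> s \<notin> ?I"
    have "y = 0" if "g y = s * y" for y
    proof (rule ccontr)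
      assume "y \<noteq> 0"
      then have "g y \<noteq> 0" "s = g y / y" using that s by auto
      then show False using s by blast
    qed
    then show "s \<in> free_slopes" by (simp add: free_slopes_def)
  qed
  then have "free_slopes = UNIV - insert 0 ?I" by auto
  moreover have "0 \<notin> ?I" using nz by auto
  ultimately have "card free_slopes = CARD('a) - (1 + card ?I)" by (simp add: card_Diff_subset)
  moreover have "card {y. g y = 0} \<le> CARD('a)" by (simp add: card_mono)
  moreover have "card {y. g y = 0} > 0" using g_0 by (auto simp: card_gt_0_iff)
  ultimately show ?thesis using I by simp
qed

text \<open>With \<open>Q\<close> always true this counts the arc; with \<open>Q\<close> the
  equation of a line it counts an intersection.\<close>

lemma card_reps_filter:
  "card {v \<in> reps. Q v} = card {y. Q (vector [g y, y, 1])}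
     + card {s \<in> free_slopes. Q (vector [s, 1, 0])} + (if Q (vector [1, 0, 0]) then 1 else 0)"
proof -
  let ?A = "(\<lambda>y. vector [g y, y, 1] :: 'a ^ 3) ` {y. Q (vector [g y, y, 1])}"
  let ?B = "(\<lambda>s. vector [s, 1, 0] :: 'a ^ 3) ` {s \<in> free_slopes. Q (vector [s, 1, 0])}"
  let ?C = "if Q (vector [1, 0, 0]) then {vector [1, 0, 0] :: 'a ^ 3} else {}"
  have "{v \<in> reps. Q v} = ?A \<union> ?B \<union> ?C" by (auto simp: reps_def)
  moreover have "?A \<inter> ?B = {}" "(?A \<union> ?B) \<inter> ?C = {}" by (auto simp: vec3_eq_iff)
  ultimately have "card {v \<in> reps. Q v} = card ?A + card ?B + card ?C"
    by (simp add: card_Un_disjoint)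
  moreover have "card ?A = card {y. Q (vector [g y, y, 1])}"
    "card ?B = card {s \<in> free_slopes. Q (vector [s, 1, 0])}"
    by (auto intro!: card_image inj_onI simp: vec3_eq_iff)
  ultimately show ?thesis by simp
qed

lemma card_arc: "card arc = CARD('a) + card {y. g y = 0}"
  using card_reps_filter[of "\<lambda>_. True"] card_image[OF inj_on_reps] card_free_slopes
  by (simp add: arc_def)

lemma card_arc_line:
  "card (arc \<inter> points_on (line_of n)) =
     card {y. n$1 * g y + n$2 * y + n$3 = 0} + card {s \<in> free_slopes. n$1 * s + n$2 = 0}
     + (if n$1 = 0 then 1 else 0)"
proof -
  have "arc \<inter> points_on (line_of n) = point_of ` {v \<in> reps. dot3 n v = 0}"
    using reps_nonzero by (auto simp: arc_def point_of_on)
  moreover have "inj_on point_of {v \<in> reps. dot3 n v = 0}"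
    by (rule inj_on_subset[OF inj_on_reps]) blast
  ultimately show ?thesis by (simp add: card_image card_reps_filter dot3_def)
qed

lemma card_arc_infinity_line: "card (arc \<inter> points_on infinity_line) = card {y. g y = 0}"
  using card_free_slopes by (simp add: infinity_line_def card_arc_line)

text \<open>The cases are the line at infinity, the other lines through \<open>(1, 0, 0)\<close>,
  which contain one further arc point, and the lines through some \<open>(s, 1, 0)\<close>.\<close>

lemma card_arc_line_cases:
  assumes "n \<noteq> 0"
  shows "card (arc \<inter> points_on (line_of n)) \<in> {0, 2, card {y. g y = 0}}"
proof -
  consider "n$1 = 0" "n$2 = 0" | "n$1 = 0" "n$2 \<noteq> 0" | "n$1 \<noteq> 0" by blast
  then show ?thesis
  proof cases
    case 1
    then have "n$3 \<noteq> 0" using assms by (auto simp: vec3_eq_iff)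
    then show ?thesis using 1 card_free_slopes by (simp add: card_arc_line)
  next
    case 2
    then have "{y. n$2 * y + n$3 = 0} = {n$3 / n$2}"
      by (auto simp: add_eq_0 field_simps)
    then show ?thesis using 2 by (simp add: card_arc_line)
  next
    case 3
    \<comment> \<open>The line meets infinity in \<open>(s, 1, 0)\<close>, signs being irrelevant in
      characteristic 2. Its affine arc points correspond to a fibre of \<open>?L\<close>.\<close>
    define s where "s = n$2 / n$1"
    let ?L = "\<lambda>y. g y + s * y"
    have L_add: "?L (x + y) = ?L x + ?L y" for x y by (simp add: add algebra_simps)
    have aff: "n$1 * g y + n$2 * y + n$3 = 0 \<longleftrightarrow> ?L y = n$3 / n$1" for y
      using 3 by (auto simp: add_eq_0 s_def field_simps)
    have inf: "n$1 * r + n$2 = 0 \<longleftrightarrow> r = s" for r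
      using 3 by (auto simp: add_eq_0 s_def field_simps)
    have count: "card (arc \<inter> points_on (line_of n)) =
        card {y. ?L y = n$3 / n$1} + card {r \<in> free_slopes. r = s}"
      using 3 unfolding card_arc_line aff inf by simp
    have fibre: "card {y. ?L y = n$3 / n$1} = (if n$3 / n$1 \<in> range ?L then card {y. ?L y = 0} else 0)"
      by (rule card_fibre_additive) (rule L_add)
    have ker: "{y. ?L y = 0} = {y. g y = s * y}" by (simp add: add_eq_0)
    show ?thesis
    proof (cases "s \<in> free_slopes")
      case True
      \<comment> \<open>A free slope makes \<open>?L\<close> injective, hence bijective: one affine
        point plus the point at infinity.\<close>
      then have k: "{y. ?L y = 0} = {0}" unfolding ker using g_0 by (auto simp: free_slopes_def)
      then have "card (range ?L) = CARD('a)" using card_range_additive[of ?L, OF L_add] by simp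
      then have "range ?L = UNIV" by (simp add: card_eq_UNIV_imp_eq_UNIV)
      moreover have "{r \<in> free_slopes. r = s} = {s}" using True by auto
      ultimately show ?thesis using count fibre k by simp
    next
      case False
      then have D: "{r \<in> free_slopes. r = s} = {}" by auto
      \<comment> \<open>Only affine points remain, in number 0 or the kernel size of
        \<open>?L\<close>. For \<open>s = 0\<close> this is the kernel of \<open>g\<close>;
        otherwise \<open>slope_inj\<close> leaves just two elements.\<close>
      have "card {y. ?L y = 0} \<in> {2, card {y. g y = 0}}"
      proof (cases "s = 0")
        case True
        then show ?thesis by simp
      next
        case s: False
        obtain y where y: "y \<noteq> 0" "g y = s * y" using False by (auto simp: free_slopes_def)
        have "z = 0 \<or> z = y" if "g z = s * z" for z
          using slope_inj[of y z] that y s by auto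
        then have "{y. ?L y = 0} = {0, y}" unfolding ker using y g_0 by auto
        then show ?thesis using y by simp
      qed
      then show ?thesis using count fibre D by auto
    qed
  qed
qed

text \<open>By finiteness, a nontrivial kernel keeps \<open>g\<close> from being onto. For
  \<open>d\<close> outside its range the line \<open>x = d\<close> misses the graph, and its point
  at infinity has slope 0, which is not free.\<close>

lemma ex_passant: "\<exists>n. n \<noteq> 0 \<and> card (arc \<inter> points_on (line_of n)) = 0"
proof -
  have "\<not> inj g" using kernel g_0 by (metis injD)
  then obtain d where d: "d \<notin> range g" using finite_UNIV_surj_inj[of g] by fastforce
  define n where "n = (vector [1, 0, d] :: 'a ^ 3)"
  have "{y. g y + d = 0} = {}" using d by (auto simp: add_eq_0)
  moreover have "{s \<in> free_slopes. s = 0} = {}" using zero_not_free by auto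
  ultimately have "card (arc \<inter> points_on (line_of n)) = 0" by (simp add: card_arc_line n_def)
  moreover have "n \<noteq> 0" by (simp add: n_def vec3_eq_iff)
  ultimately show ?thesis by blast
qed

lemma arc_line_card_range: "(\<lambda>l. card (arc \<inter> points_on l)) ` pg_lines = {0, 2, card {y. g y = 0}}"
proof (intro equalityI subsetI)
  fix k assume "k \<in> (\<lambda>l. card (arc \<inter> points_on l)) ` pg_lines"
  then show "k \<in> {0, 2, card {y. g y = 0}}"
    using card_arc_line_cases by (elim imageE pg_lines_cases) metis
next
  \<comment> \<open>The line \<open>y = 0\<close> contains the arc points \<open>(0, 0, 1)\<close>
    and \<open>(1, 0, 0)\<close>; the line at infinity attains the kernel size.\<close>
  have "line_of (vector [0, 1, 0]) \<in> (pg_lines :: ('a ^ 3) set set)"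
    "infinity_line \<in> (pg_lines :: ('a ^ 3) set set)"
    by (simp_all add: infinity_line_def line_of_in_pg_lines vec3_eq_iff)
  moreover have "card (arc \<inter> points_on (line_of (vector [0, 1, 0]))) = 2"
    by (simp add: card_arc_line)
  moreover obtain n where "n \<noteq> 0" "card (arc \<inter> points_on (line_of n)) = 0" using ex_passant by blast
  moreover fix k assume "k \<in> {0, 2, card {y. g y = 0}}"
  ultimately show "k \<in> (\<lambda>l. card (arc \<inter> points_on l)) ` pg_lines"
    using card_arc_infinity_line line_of_in_pg_lines[of n] by (auto intro: rev_image_eqI)
qed

lemma arc_subset: "arc \<subseteq> pg_points"
  using reps_nonzero by (auto simp: arc_def point_of_in_pg_points)

lemma arc_affine: "P \<in> arc - points_on infinity_line \<Longrightarrow> \<exists>y. P = point_of (vector [g y, y, 1])"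
  by (auto simp: arc_def reps_def infinity_line_def point_of_on vec3_eq_iff dot3_def)

text \<open>By additivity, translation by a graph vector preserves the graph, and points at infinity
  are fixed.\<close>

lemma shear_map_arc: "shear_map (vector [g a, a, 0]) ` arc = arc"
proof -
  define d where "d = (vector [g a, a, 0] :: 'a ^ 3)"
  have d3: "d$3 = 0" by (simp add: d_def)
  have "shear d v \<in> reps" if "v \<in> reps" for v
  proof -
    have "shear d (vector [g y, y, 1]) = vector [g (y + a), y + a, 1]" for y
      by (simp add: shear_def d_def vec3_eq_iff add)
    moreover have "shear d (vector [s, t, 0]) = vector [s, t, 0]" for s t
      by (simp add: shear_def vec3_eq_iff)
    ultimately show ?thesis using that by (auto simp: reps_def)
  qed
  then have sub: "shear_map d P \<in> arc" if "P \<in> arc" for P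
    using that reps_nonzero by (auto simp: arc_def shear_map_point_of)
  have "shear_map d ` arc = arc"
  proof
    show "arc \<subseteq> shear_map d ` arc"
      using sub shear_map_involution[OF two d3] by (metis image_eqI subsetI)
  qed (use sub in blast)
  then show ?thesis by (simp add: d_def)
qed

lemma translation_set_arc: "translation_set arc"
proof -
  have "\<exists>\<phi>\<in>elations infinity_line. \<phi> ` arc = arc \<and> \<phi> P = Q"
    if PQ: "P \<in> arc - points_on infinity_line" "Q \<in> arc - points_on infinity_line" for P Q
  proof -
    obtain y z where yz: "P = point_of (vector [g y, y, 1])" "Q = point_of (vector [g z, z, 1])"
      using arc_affine[OF PQ(1)] arc_affine[OF PQ(2)] by blast
    \<comment> \<open>In characteristic 2 the sum \<open>y + z\<close> is also the difference, so
      this translation takes \<open>P\<close> to \<open>Q\<close>.\<close>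
    define d where "d = (vector [g (y + z), y + z, 0] :: 'a ^ 3)"
    have "shear d (vector [g y, y, 1]) = vector [g z, z, 1]"
      by (simp add: shear_def d_def vec3_eq_iff add add_self flip: add.assoc)
    moreover have "vector [g y, y, 1] \<noteq> (0 :: 'a ^ 3)" by (simp add: vec3_eq_iff)
    ultimately have "shear_map d P = Q"
      by (simp add: yz shear_map_point_of)
    moreover have "shear_map d \<in> elations infinity_line"
      by (rule shear_map_elation[OF two]) (simp add: d_def)
    ultimately show ?thesis using shear_map_arc[of "y + z"] unfolding d_def by blast
  qed
  moreover have "infinity_line \<in> (pg_lines :: ('a ^ 3) set set)"
    by (simp add: infinity_line_def line_of_in_pg_lines vec3_eq_iff)
  ultimately show ?thesis
    unfolding translation_set_def translation_set_wrt_def using arc_subset by blast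
qed

lemma translation_KM_arc_arc: "translation_KM_arc (card {y. g y = 0}) arc"
  unfolding translation_KM_arc_def KM_arc_def
  using arc_subset card_arc arc_line_card_range translation_set_arc by blast

end

section \<open>Fields of even order and an additive map with kernel of size q/4\<close>

lemma even_card_field_two_eq_0:
  assumes "even CARD('a::{field, finite})"
  shows "(2::'a) = 0"
proof -
  \<comment> \<open>Negation permutes the nonzero elements; comparing products gives
    \<open>(-1)^(q-1) = 1\<close> with \<open>q - 1\<close> odd.\<close>
  let ?U = "UNIV - {0} :: 'a set"
  have "(\<Prod>x\<in>?U. x) = (\<Prod>x\<in>?U. - x)"
    by (rule prod.reindex_bij_witness[of _ uminus uminus]) auto
  also have "\<dots> = (-1) ^ card ?U * (\<Prod>x\<in>?U. x)"
    using prod.distrib[of "\<lambda>_. -1" "\<lambda>x. x" ?U] by simp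
  finally have "(-1) ^ card ?U = (1::'a)" by simp
  moreover have "odd (card ?U)"
    using assms by (simp add: card_Diff_subset)
  ultimately have "-1 = (1::'a)" by simp
  then show ?thesis by (metis add.right_inverse one_add_one)
qed

text \<open>This is a linear functional over the prime field, its values read in \<open>'a\<close>:
  the indicator of the complement of an index 2 subgroup avoiding 1.\<close>

lemma ex_additive_functional:
  assumes two: "(2::'a::{field, finite}) = 0"
  obtains f :: "'a::{field, finite} \<Rightarrow> 'a" where "\<And>x y. f (x + y) = f x + f y" "\<And>x. f x = 0 \<or> f x = 1" "f 1 = 1"
proof -
  have self: "x + x = 0" for x :: 'a using two by (rule two_eq_0_add_self)
  have self': "x + (x + y) = y" for x y :: 'a using self by (simp flip: add.assoc)
  define S where "S = {H :: 'a set. 0 \<in> H \<and> (\<forall>x\<in>H. \<forall>y\<in>H. x + y \<in> H) \<and> 1 \<notin> H}"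
  have "{0} \<in> S" by (auto simp: S_def)
  \<comment> \<open>A maximal additive subgroup \<open>H\<close> avoiding 1 has index 2, since \<open>H \<union> (x + H)\<close> contains 1 for \<open>x \<notin> H\<close>.\<close>
  then obtain H where H: "H \<in> S" and max: "\<And>K. K \<in> S \<Longrightarrow> H \<subseteq> K \<Longrightarrow> H = K"
    using finite_has_maximal[of S] by (metis empty_iff finite_class.finite)
  have H0: "0 \<in> H" and Hadd: "\<And>x y. x \<in> H \<Longrightarrow> y \<in> H \<Longrightarrow> x + y \<in> H" and H1: "1 \<notin> H"
    using H by (auto simp: S_def)
  have coset: "1 + x \<in> H" if x: "x \<notin> H" for x
  proof -
    define K where "K = H \<union> (\<lambda>h. x + h) ` H"
    have "x \<in> K" using H0 by (force simp: K_def)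
    then have "K \<notin> S" using max[of K] x by (auto simp: K_def)
    moreover have "u + v \<in> K" if "u \<in> K" "v \<in> K" for u v
    proof -
      have "h + (x + h') = x + (h + h')" "(x + h) + (x + h') = h + h'" for h h'
        using self' by (simp_all add: ac_simps)
      then show ?thesis using that Hadd unfolding K_def
        by (elim UnE imageE) (auto simp: add.assoc)
    qed
    ultimately have "1 \<in> K" using H0 by (auto simp: S_def K_def)
    then obtain h where "h \<in> H" "1 = x + h" using H1 by (auto simp: K_def)
    then show ?thesis using self' by (metis add.commute)
  qed
  define f where "f = (\<lambda>x. if x \<in> H then 0 else 1 :: 'a)"
  have "f (x + y) = f x + f y" for x y
  proof -
    have out: "x + y \<notin> H" if "x \<in> H" "y \<notin> H" for x y
      using Hadd[of x "x + y"] that self' by metis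
    have "x + y \<in> H" if "x \<notin> H" "y \<notin> H"
    proof -
      have "(1 + x) + (1 + y) = x + y" using self'[of 1 "x + y"] by (simp add: ac_simps)
      then show ?thesis using Hadd[OF coset coset, OF that] by simp
    qed
    then show ?thesis using Hadd[of x y] out[of x y] out[of y x]
      by (cases "x \<in> H"; cases "y \<in> H") (simp_all add: f_def two add.commute)
  qed
  then show ?thesis using H1 by (intro that[of f]) (auto simp: f_def)
qed

lemma ex_translation_map:
  assumes even: "even CARD('a::{field, finite})" and card8: "CARD('a) \<ge> 8"
  obtains g :: "'a::{field, finite} \<Rightarrow> 'a" where "translation_map g" "CARD('a) = 4 * card {y. g y = 0}"
proof -
  have two: "(2::'a) = 0" using even by (rule even_card_field_two_eq_0)
  obtain f :: "'a \<Rightarrow> 'a" where f_add: "\<And>x y. f (x + y) = f x + f y"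
    and f_cases: "\<And>x. f x = 0 \<or> f x = 1" and f1: "f 1 = 1"
    using ex_additive_functional[OF two] by blast
  have self: "x + x = 0" for x :: 'a using two by (rule two_eq_0_add_self)
  have f0: "f 0 = 0" using f_add[of 0 0] by (metis self)
  have "card {0, 1 :: 'a} < CARD('a)" using card8 by simp
  then have "{0, 1 :: 'a} \<noteq> UNIV" by force
  then obtain b :: 'a where b: "b \<noteq> 0" "b \<noteq> 1" by blast
  have b1: "1 + b \<noteq> 0" using b self[of 1] by (metis add_left_cancel)
  define g where "g = (\<lambda>y. f y + (1 + b) * f (b * y))"
  have g_add: "g (x + y) = g x + g y" for x y by (simp add: g_def f_add algebra_simps)
  \<comment> \<open>The pair \<open>(f y, f (b * y))\<close> takes all four values in
    \<open>{0, 1}^2\<close>, so \<open>g\<close> has four values and a kernel of size q/4.\<close>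
  have "\<exists>y. f y = 1 \<and> f (b * y) = 0" "\<exists>y. f y = 0 \<and> f (b * y) = 1" "\<exists>y. f y = 1 \<and> f (b * y) = 1"
  proof -
    let ?P = "\<lambda>p r. \<exists>y. f y = p \<and> f (b * y) = r"
    have sum: "?P (p + p') (r + r')" if "?P p r" "?P p' r'" for p r p' r'
      using that by (metis f_add distrib_left)
    \<comment> \<open>The witnesses \<open>1\<close>, \<open>1 / b\<close> and
      \<open>1 / (1 + b)\<close> show in turn that the first entry, the second entry and their sum
      are not identically 0. Hence at least two of the three nonzero pairs occur, and
      \<open>sum\<close> supplies the third.\<close>
    have f1': "f (b * (1 / b)) = 1" "f (1 / (1 + b)) + f (b * (1 / (1 + b))) = 1"
      using f1 b b1 f_add[of "1 / (1 + b)" "b * (1 / (1 + b))"] by (simp_all flip: add_divide_distrib)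
    have "?P 1 0 \<or> ?P 1 1" using f1 f_cases[of "b * 1"] by metis
    moreover have "?P 0 1 \<or> ?P 1 1" using f1'(1) f_cases[of "1 / b"] by metis
    moreover have "?P 1 0 \<or> ?P 0 1"
      using f1'(2) f_cases[of "1 / (1 + b)"] f_cases[of "b * (1 / (1 + b))"] self[of 1]
      by (metis add_0 zero_neq_one)
    ultimately show "?P 1 0" "?P 0 1" "?P 1 1"
      using sum[of 1 0 1 1] sum[of 0 1 1 1] sum[of 1 0 0 1] self[of 1] by auto
  qed
  then obtain y1 y2 y3 where "f y1 = 1" "f (b * y1) = 0" "f y2 = 0" "f (b * y2) = 1"
    "f y3 = 1" "f (b * y3) = 1" by blast
  moreover have e: "1 + (1 + b) = b" using self[of 1] by (simp flip: add.assoc)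
  ultimately have "g 0 = 0" "g y1 = 1" "g y2 = 1 + b" "g y3 = b"
    by (simp_all add: g_def f0)
  then have "{0, 1, 1 + b, b} \<subseteq> range g" by (metis insert_subset empty_subsetI rangeI)
  moreover have "g y \<in> {0, 1, 1 + b, b}" for y
    using f_cases[of y] f_cases[of "b * y"] e by (auto simp: g_def)
  ultimately have "range g = {0, 1, 1 + b, b}" by blast
  then have "card (range g) = 4" using b b1 by auto
  then have card: "CARD('a) = 4 * card {y. g y = 0}"
    using card_range_additive[of g, OF g_add] by simp
  \<comment> \<open>The pairs \<open>(1, 0)\<close>, \<open>(0, 1)\<close>, \<open>(1, 1)\<close>
    give \<open>g\<close> the values \<open>1\<close>, \<open>1 + b\<close>, \<open>b\<close>. The
    alternatives are the choices of two distinct pairs, up to exchanging \<open>y\<close> and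
    \<open>z\<close>.\<close>
  have no: False if "f y = 1 \<and> f (b * y) = 0 \<and> f z = 0 \<and> f (b * z) = 1 \<or>
      f y = 1 \<and> f (b * y) = 0 \<and> f z = 1 \<and> f (b * z) = 1 \<or>
      f y = 0 \<and> f (b * y) = 1 \<and> f z = 1 \<and> f (b * z) = 1" "g y * z = g z * y" for y z
    using that(1)
  proof (elim disjE conjE)
    assume *: "f y = 1" "f (b * y) = 0" "f z = 0" "f (b * z) = 1"
    then have "z = y + b * y" using that(2) by (simp add: g_def algebra_simps)
    then show False using * f_add by simp
  next
    assume *: "f y = 1" "f (b * y) = 0" "f z = 1" "f (b * z) = 1"
    then have "z = b * y" using that(2) e by (simp add: g_def)
    then show False using * by simp
  next
    assume *: "f y = 0" "f (b * y) = 1" "f z = 1" "f (b * z) = 1"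
    then have "z + b * z = b * y" using that(2) e by (simp add: g_def algebra_simps)
    then show False using * f_add[of z "b * z"] self[of 1] by simp
  qed
  have "translation_map g"
  proof
    fix y z assume eq: "g y * z = g z * y" and nz: "g y * z \<noteq> 0"
    have ny: "f y \<noteq> 0 \<or> f (b * y) \<noteq> 0" using nz by (auto simp: g_def)
    have "g z * y \<noteq> 0" using eq nz by metis
    then have nz': "f z \<noteq> 0 \<or> f (b * z) \<noteq> 0" by (auto simp: g_def)
    have "f y = f z \<and> f (b * y) = f (b * z)"
      using ny nz' no[OF _ eq] no[OF _ eq[symmetric]]
        f_cases[of y] f_cases[of z] f_cases[of "b * y"] f_cases[of "b * z"] by auto
    then have "g y = g z" by (simp only: g_def)
    then show "y = z" using eq nz by (metis mult_cancel_left mult_eq_0_iff)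
  next
    \<comment> \<open>The kernel has q/4 elements, hence at least two.\<close>
    have "\<not> {y. g y = 0} \<subseteq> {0}" using card card8 card_mono[of "{0}" "{y. g y = 0}"] by auto
    then show "\<exists>w. w \<noteq> 0 \<and> g w = 0" by blast
  qed (use two g_add in simp_all)
  then show ?thesis using card that by blast
qed

section \<open>Translation KM-arcs of type q/4\<close>

lemma ex_translation_KM_arc_quarter:
  assumes "even CARD('a::{field, finite})" "CARD('a) \<ge> 8"
  shows "\<exists>A :: ('a ^ 3) set set. translation_KM_arc (CARD('a) div 4) A"
proof -
  obtain g :: "'a \<Rightarrow> 'a" where "translation_map g" and card: "CARD('a) = 4 * card {y. g y = 0}"
    using ex_translation_map[OF assms] by blast
  then interpret translation_map g by simp
  from card have "CARD('a) div 4 = card {y. g y = 0}" by simp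
  then show ?thesis using translation_KM_arc_arc by metis
qed

theorem theorem2p13:
  shows "(\<forall>h::nat. h \<ge> 3 \<and> CARD('a::{field,finite}) = 2 ^ h \<longrightarrow>
            (\<exists>A :: ('a ^ 3) set set. translation_KM_arc (2 ^ (h - 2)) A)) \<and>
         (even CARD('a) \<and> CARD('a) \<ge> 8 \<longrightarrow>
            (\<exists>A :: ('a ^ 3) set set. translation_set A \<and>
               card A = CARD('a) + CARD('a) div 4 \<and>
               (\<forall>l\<in>pg_lines. card (A \<inter> points_on l) \<in> {0, 2, CARD('a) div 4})))"
proof (intro conjI allI impI)
  fix h :: nat assume h: "h \<ge> 3 \<and> CARD('a) = 2 ^ h"
  \<comment> \<open>This removes the truncated subtraction in \<open>h - 2\<close>.\<close>
  then obtain k where k: "h = 3 + k" using le_Suc_ex by blast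
  then have "even CARD('a)" "CARD('a) \<ge> 8" "CARD('a) div 4 = 2 ^ (h - 2)"
    using h by (simp_all add: power_add)
  then show "\<exists>A :: ('a ^ 3) set set. translation_KM_arc (2 ^ (h - 2)) A"
    using ex_translation_KM_arc_quarter by metis
next
  assume "even CARD('a) \<and> CARD('a) \<ge> 8"
  then obtain A :: "('a ^ 3) set set" where "translation_KM_arc (CARD('a) div 4) A"
    using ex_translation_KM_arc_quarter by blast
  then have "translation_set A" "card A = CARD('a) + CARD('a) div 4"
    "(\<lambda>l. card (A \<inter> points_on l)) ` pg_lines = {0, 2, CARD('a) div 4}"
    by (simp_all add: translation_KM_arc_def KM_arc_def)
  then show "\<exists>A :: ('a ^ 3) set set. translation_set A \<and>
      card A = CARD('a) + CARD('a) div 4 \<and>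
      (\<forall>l\<in>pg_lines. card (A \<inter> points_on l) \<in> {0, 2, CARD('a) div 4})"
    by (metis imageI)
qed

end
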